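(* For every even integer $k\ge0$, the polynomial $R_{k,2}\in\mathbb{Z}[b]$ is either constant or irreducible over $\mathbb{Q}$.
   Context: For $b\in\mathbb{C}$ let $f_b(z)=z^3+b$, whose only finite critical point is $0$. A point $x$ is strictly $n$-periodic under $f$ if $n$ is the smallest positive integer with $f^n(x)=x$ ($f^m$ being the $m$-fold iterate). A point $x$ is strictly $(k,n)$-preperiodic if $f^k(x)$ is strictly $n$-periodic and $f^l(x)$ is not periodic for any $0\le l<k$. For integers $k\ge0$, $n\ge1$, $R_{k,n}\in\mathbb{Z}[b]$ denotes the monic polynomial whose roots, each simple, are exactly the values of $b\in\mathbb{C}$ for which $0$ is strictly $(k,n)$-preperiodic under $f_b$ (with $R_{k,n}=1$ if there are none). *)

theory Defs
  imports Complex_Main "HOL-Computational_Algebra.Computational_Algebra"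
begin

definition periodic :: "('a \<Rightarrow> 'a) \<Rightarrow> 'a \<Rightarrow> bool" where
  "periodic f x \<longleftrightarrow> (\<exists>n>0. (f ^^ n) x = x)"

definition strictly_periodic :: "nat \<Rightarrow> ('a \<Rightarrow> 'a) \<Rightarrow> 'a \<Rightarrow> bool" where
  "strictly_periodic n f x \<longleftrightarrow>
     0 < n \<and> (f ^^ n) x = x \<and> (\<forall>m. 0 < m \<and> m < n \<longrightarrow> (f ^^ m) x \<noteq> x)"

definition strictly_preperiodic :: "nat \<Rightarrow> nat \<Rightarrow> ('a \<Rightarrow> 'a) \<Rightarrow> 'a \<Rightarrow> bool" where
  "strictly_preperiodic k n f x \<longleftrightarrow>
     strictly_periodic n f ((f ^^ k) x) \<and> (\<forall>l<k. \<not> periodic f ((f ^^ l) x))"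

definition cubic :: "complex \<Rightarrow> complex \<Rightarrow> complex" where
  "cubic b z = z ^ 3 + b"

definition is_preperiodic_poly :: "nat \<Rightarrow> nat \<Rightarrow> int poly \<Rightarrow> bool" where
  "is_preperiodic_poly k n p \<longleftrightarrow>
     lead_coeff p = 1 \<and>
     rsquarefree (map_poly of_int p :: complex poly) \<and>
     (\<forall>b. poly (map_poly of_int p) b = 0 \<longleftrightarrow> strictly_preperiodic k n (cubic b) 0)"

(* Well defined: see ex1_preperiodic_poly at the end of this theory. *)
definition preperiodic_poly :: "nat \<Rightarrow> nat \<Rightarrow> int poly" where
  "preperiodic_poly k n = (THE p. is_preperiodic_poly k n p)"


abbreviation cpoly :: "int poly \<Rightarrow> complex poly" where
  "cpoly \<equiv> map_poly of_int"

lemma cpoly_simps [simp]: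
  "cpoly (p + q) = cpoly p + cpoly q"
  "cpoly (p - q) = cpoly p - cpoly q"
  "cpoly (p * q) = cpoly p * cpoly q"
  "cpoly (smult c p) = smult (of_int c) (cpoly p)"
  by (rule poly_eqI; simp add: coeff_map_poly coeff_mult)+

lemma cpoly_power [simp]: "cpoly (p ^ n) = cpoly p ^ n"
  by (induction n) simp_all

lemma cpoly_prod: "cpoly (prod f S) = (\<Prod>x\<in>S. cpoly (f x))"
  by (induction S rule: infinite_finite_induct) simp_all

lemma cpoly_pderiv: "cpoly (pderiv p) = pderiv (cpoly p)"
  by (rule poly_eqI) (simp add: coeff_map_poly coeff_pderiv)

lemma cpoly_inj: "cpoly p = cpoly q \<Longrightarrow> p = q"
  by (metis (no_types, lifting) coeff_map_poly of_int_0 of_int_eq_iff poly_eqI)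

lemma degree_cpoly [simp]: "degree (cpoly p) = degree p"
  by (rule degree_map_poly) simp

lemma poly_cpoly_degree_0:
  assumes "degree p = 0" "poly (cpoly p) b = 0"
  shows "p = 0"
  using assms by (auto elim!: degree_eq_zeroE simp: map_poly_pCons)

lemma prime_poly_dvd_of_common_root:
  fixes q B :: "int poly"
  assumes q: "prime_elem q" and qb: "poly (cpoly q) b = 0" and Bb: "poly (cpoly B) b = 0"
  shows "q dvd B"
proof -
  have q0: "q \<noteq> 0" using q by auto
  define P where "P = (\<lambda>m. m \<noteq> 0 \<and> poly (cpoly m) b = 0)"
  obtain m where m: "P m" and mmin: "\<And>r. P r \<Longrightarrow> degree m \<le> degree r"
    using ex_has_least_nat[of P q degree] q0 qb unfolding P_def by blast
  have m0: "m \<noteq> 0" and mb: "poly (cpoly m) b = 0" using m by (auto simp: P_def)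
  have mdeg: "degree m > 0" using poly_cpoly_degree_0[OF _ mb] m0 by blast
  have div: "\<exists>a s. a \<noteq> 0 \<and> smult a h = m * s" if hb: "poly (cpoly h) b = 0" for h
  proof -
    obtain a s where a: "a \<noteq> 0" "smult a h = m * s + pseudo_mod h m"
      using pseudo_mod(1)[OF m0, of h] by blast
    have "pseudo_mod h m = smult a h - m * s" using a by simp
    hence rb: "poly (cpoly (pseudo_mod h m)) b = 0" using hb mb by simp
    have "\<not> degree (pseudo_mod h m) < degree m" if "pseudo_mod h m \<noteq> 0"
      using mmin[of "pseudo_mod h m"] rb that by (simp add: P_def)
    hence "pseudo_mod h m = 0" using pseudo_mod(2)[OF m0, of h] by blast
    thus ?thesis using a by auto
  qed
  have qdeg: "degree q > 0" using poly_cpoly_degree_0[OF _ qb] q0 by blast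
  have qc: "\<not> q dvd [:a:]" if "a \<noteq> 0" for a
    using dvd_imp_degree_le[of q "[:a:]"] that qdeg by auto
  obtain a s where as: "a \<noteq> 0" "smult a q = m * s" using div[OF qb] by blast
  have "q dvd m * s" unfolding as(2)[symmetric] by (simp add: dvd_smult)
  hence "q dvd m \<or> q dvd s" using q by (simp add: prime_elem_dvd_mult_iff)
  moreover have "\<not> q dvd s"
  proof
    assume "q dvd s"
    hence "degree q \<le> degree s" using as q0 by (intro dvd_imp_degree_le) auto
    moreover have "degree q = degree m + degree s"
    proof -
      have "s \<noteq> 0" using as q0 by auto
      hence "degree (m * s) = degree m + degree s" using m0 by (simp add: degree_mult_eq)
      thus ?thesis using as by (metis degree_smult_eq)
    qed
    ultimately show False using mdeg by simp
  qed
  ultimately have qm: "q dvd m" by blast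
  obtain a' s' where as': "a' \<noteq> 0" "smult a' B = m * s'" using div[OF Bb] by blast
  have "q dvd [:a':] * B" using qm as' by simp
  thus ?thesis using q qc[OF as'(1)] by (simp only: prime_elem_dvd_mult_iff) blast
qed

lemma ex_monic_rsquarefree:
  fixes A B :: "int poly"
  assumes A: "lead_coeff A = 1"
  shows "\<exists>p :: int poly. lead_coeff p = 1 \<and> rsquarefree (cpoly p) \<and>
    (\<forall>b. poly (cpoly p) b = 0 \<longleftrightarrow> poly (cpoly A) b = 0 \<and> poly (cpoly B) b \<noteq> 0)"
proof -
  have A0: "A \<noteq> 0" using A by auto
  define S where "S = {q \<in> prime_factors A. \<not> q dvd B}"
  have fin: "finite S" by (simp add: S_def)
  have S: "prime q" "q dvd A" "\<not> q dvd B" if "q \<in> S" for q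
    using that by (auto simp: S_def in_prime_factors_iff)
  have monic: "lead_coeff q = 1" if "q \<in> S" for q
  proof -
    have "q dvd A" using S(2) that by blast
    then obtain r where r: "A = q * r" by blast
    have "lead_coeff q * lead_coeff r = 1" using A unfolding r lead_coeff_mult .
    hence unit: "is_unit (lead_coeff q)" by (metis dvd_triv_left)
    have "unit_factor q = 1" using S(1)[OF that] by auto
    hence "unit_factor (lead_coeff q) = 1"
      by (simp add: unit_factor_poly_def one_pCons)
    thus ?thesis using unit by (auto simp: sgn_if split: if_splits)
  qed
  define p where "p = \<Prod>S"
  have lp: "lead_coeff p = 1"
    unfolding p_def lead_coeff_prod using monic by (simp add: prod.neutral)
  have root_p: "poly (cpoly p) b = 0 \<longleftrightarrow> (\<exists>q\<in>S. poly (cpoly q) b = 0)" for b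
    unfolding p_def using fin by (simp add: cpoly_prod poly_prod)
  have "poly (cpoly p) b = 0 \<longleftrightarrow> poly (cpoly A) b = 0 \<and> poly (cpoly B) b \<noteq> 0" for b
  proof
    assume "poly (cpoly p) b = 0"
    then obtain q where q: "q \<in> S" "poly (cpoly q) b = 0" using root_p by blast
    obtain r where r: "A = q * r" using S(2)[OF q(1)] by blast
    have "poly (cpoly A) b = 0" using q r by simp
    moreover have "poly (cpoly B) b \<noteq> 0"
      using prime_poly_dvd_of_common_root[of q b B] S[OF q(1)] q(2) by auto
    ultimately show "poly (cpoly A) b = 0 \<and> poly (cpoly B) b \<noteq> 0" by blast
  next
    assume AB: "poly (cpoly A) b = 0 \<and> poly (cpoly B) b \<noteq> 0"
    have "A dvd prod_mset (prime_factorization A)"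
      using prod_mset_prime_factorization_weak[OF A0] by (metis dvd_normalize_iff dvd_refl)
    then obtain r where r: "prod_mset (prime_factorization A) = A * r" by blast
    have ev: "poly (cpoly (prod_mset M)) b = 0 \<Longrightarrow> \<exists>q\<in>#M. poly (cpoly q) b = 0" for M
      by (induction M) auto
    obtain q where q: "q \<in># prime_factorization A" "poly (cpoly q) b = 0"
      using ev[of "prime_factorization A"] AB r by auto
    have "\<not> q dvd B" using q AB by auto
    hence "q \<in> S" using q by (simp add: S_def)
    thus "poly (cpoly p) b = 0" using q root_p by blast
  qed
  moreover have "rsquarefree (cpoly p)"
    unfolding rsquarefree_roots
  proof (intro allI notI, elim conjE)
    fix b assume pb: "poly (cpoly p) b = 0" and p'b: "poly (pderiv (cpoly p)) b = 0"
    obtain q where q: "q \<in> S" "poly (cpoly q) b = 0" using pb root_p by blast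
    have qp: "prime_elem q" using S(1)[OF q(1)] by simp
    have p: "p = q * \<Prod>(S - {q})" unfolding p_def using fin q(1) by (rule prod.remove)
    have "poly (cpoly (pderiv q)) b * poly (cpoly (\<Prod>(S - {q}))) b = 0"
      using p'b q(2) by (subst (asm) p) (auto simp: pderiv_mult cpoly_pderiv)
    then consider "poly (cpoly (pderiv q)) b = 0" | "poly (cpoly (\<Prod>(S - {q}))) b = 0"
      by auto
    thus False
    proof cases
      case 1
      have "q dvd pderiv q" by (rule prime_poly_dvd_of_common_root[OF qp q(2) 1])
      moreover have qdeg: "degree q \<noteq> 0"
        using poly_cpoly_degree_0[OF _ q(2)] qp by (auto simp: prime_elem_def)
      ultimately show False
        using dvd_imp_degree_le[of q "pderiv q"] degree_pderiv[of q] pderiv_eq_0_iff[of q] by auto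
    next
      case 2
      then obtain r where r: "r \<in> S" "r \<noteq> q" "poly (cpoly r) b = 0"
        using fin by (auto simp: cpoly_prod poly_prod)
      have "q dvd r" by (rule prime_poly_dvd_of_common_root[OF qp q(2) r(3)])
      thus False using S(1)[OF q(1)] S(1)[OF r(1)] r(2) primes_dvd_imp_eq by blast
    qed
  qed
  ultimately show ?thesis using lp by blast
qed

fun orbit_poly :: "nat \<Rightarrow> int poly" where
  "orbit_poly 0 = 0"
| "orbit_poly (Suc m) = orbit_poly m ^ 3 + [:0, 1:]"

lemma poly_orbit_poly: "poly (cpoly (orbit_poly m)) b = (cubic b ^^ m) 0"
  by (induction m) (simp_all add: cubic_def map_poly_pCons)

lemma orbit_poly_degree_monic:
  "degree (orbit_poly (Suc m)) = 3 ^ m \<and> lead_coeff (orbit_poly (Suc m)) = 1"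
proof (induction m)
  case (Suc m)
  let ?P = "orbit_poly (Suc m)"
  have d3: "degree (?P ^ 3) = 3 ^ Suc m"
    using Suc by (subst degree_power_eq) auto
  have lt: "degree [:0, 1 :: int:] < degree (?P ^ 3)"
    unfolding d3 using one_less_power[of "3::nat" "Suc m"] by simp
  have eq: "orbit_poly (Suc (Suc m)) = [:0, 1:] + ?P ^ 3"
    by (simp only: orbit_poly.simps(2)[of "Suc m"] add.commute)
  have "lead_coeff (?P ^ 3) = 1" using Suc by (metis lead_coeff_power power_one)
  moreover have "degree ([:0, 1:] + ?P ^ 3) = degree (?P ^ 3)"
    by (rule degree_add_eq_right[OF lt])
  moreover have "lead_coeff ([:0, 1:] + ?P ^ 3) = lead_coeff (?P ^ 3)"
    by (rule lead_coeff_add_le[OF lt])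
  ultimately show ?case unfolding eq using d3 by simp
qed simp

lemma orbit_poly_diff_monic:
  assumes "0 < n"
  shows "lead_coeff (orbit_poly (k + n) - orbit_poly k) = 1"
proof -
  obtain m where m: "k + n = Suc m" "k \<le> m" using assms by (cases n) auto
  have lt: "degree (orbit_poly k) < degree (orbit_poly (Suc m))"
  proof (cases k)
    case 0
    thus ?thesis using orbit_poly_degree_monic[of m] by simp
  next
    case (Suc j)
    thus ?thesis using m orbit_poly_degree_monic[of m] orbit_poly_degree_monic[of j] by simp
  qed
  hence "degree (orbit_poly (Suc m) - orbit_poly k) = degree (orbit_poly (Suc m))"
    by (metis degree_add_eq_left degree_minus diff_conv_add_uminus)
  thus ?thesis using m(1) lt orbit_poly_degree_monic[of m]
    by (metis coeff_diff coeff_eq_0 diff_zero)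
qed

lemma funpow_return_shift:
  fixes f :: "'a \<Rightarrow> 'a"
  assumes per: "periodic f y" and j: "(f ^^ n) ((f ^^ j) y) = (f ^^ j) y"
  shows "(f ^^ n) y = y"
proof -
  obtain m where m: "m > 0" "(f ^^ m) y = y" using per by (auto simp: periodic_def)
  have mul: "(f ^^ (i * m)) y = y" for i
    by (induction i) (simp_all add: funpow_add m)
  have comm: "(f ^^ a) ((f ^^ c) y) = (f ^^ c) ((f ^^ a) y)" for a c
    by (metis add.commute comp_apply funpow_add)
  have le: "j \<le> j * m" using m by simp
  have ret: "(f ^^ (j * m - j)) ((f ^^ j) y) = y"
    using mul[of j] le by (metis comp_apply funpow_add le_add_diff_inverse2)
  have "(f ^^ n) y = (f ^^ n) ((f ^^ (j * m - j)) ((f ^^ j) y))" using ret by simp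
  also have "\<dots> = (f ^^ (j * m - j)) ((f ^^ n) ((f ^^ j) y))"
    by (metis add.commute comp_apply funpow_add)
  finally show ?thesis using j ret by simp
qed

lemma strictly_preperiodic_iff:
  assumes "0 < n"
  shows "strictly_preperiodic k n f x \<longleftrightarrow>
    (f ^^ (k + n)) x = (f ^^ k) x \<and> (\<forall>m\<in>{0<..<n}. (f ^^ (k + m)) x \<noteq> (f ^^ k) x) \<and>
    (\<forall>l<k. (f ^^ (l + n)) x \<noteq> (f ^^ l) x)"
proof -
  have sh: "(f ^^ (i + m)) x = (f ^^ m) ((f ^^ i) x)" for i m
    by (metis add.commute comp_apply funpow_add)
  have "periodic f ((f ^^ l) x) \<longleftrightarrow> (f ^^ n) ((f ^^ l) x) = (f ^^ l) x"
    if l: "l < k" and k: "(f ^^ n) ((f ^^ k) x) = (f ^^ k) x" for l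
  proof
    assume "periodic f ((f ^^ l) x)"
    moreover have "(f ^^ k) x = (f ^^ (k - l)) ((f ^^ l) x)"
      using sh[of l "k - l"] l by simp
    ultimately show "(f ^^ n) ((f ^^ l) x) = (f ^^ l) x"
      using funpow_return_shift[of f "(f ^^ l) x" n "k - l"] k by simp
  qed (use assms in \<open>auto simp: periodic_def\<close>)
  thus ?thesis unfolding strictly_preperiodic_def strictly_periodic_def sh
    using assms by auto
qed

lemma is_preperiodic_poly_unique:
  assumes "is_preperiodic_poly k n p" "is_preperiodic_poly k n q"
  shows "p = q"
proof -
  have "cpoly r = (\<Prod>z | strictly_preperiodic k n (cubic z) 0. [:- z, 1:])"
    if "is_preperiodic_poly k n r" for r
    using that complex_poly_decompose_rsquarefree[of "cpoly r"]
    by (simp add: is_preperiodic_poly_def coeff_map_poly)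
  thus ?thesis using assms cpoly_inj by metis
qed

theorem ex1_preperiodic_poly: "\<exists>!p. is_preperiodic_poly k n p"
proof (rule ex_ex1I)
  show "\<exists>p. is_preperiodic_poly k n p"
  proof (cases "n = 0")
    case True
    have "is_preperiodic_poly k n 1"
      using True by (auto simp: is_preperiodic_poly_def strictly_preperiodic_def
          strictly_periodic_def rsquarefree_roots)
    thus ?thesis by blast
  next
    case False
    hence n: "0 < n" by simp
    define B where "B = (\<Prod>m\<in>{0<..<n}. orbit_poly (k + m) - orbit_poly k) *
      (\<Prod>l<k. orbit_poly (l + n) - orbit_poly l)"
    have "poly (cpoly (orbit_poly (k + n) - orbit_poly k)) b = 0 \<and> poly (cpoly B) b \<noteq> 0
      \<longleftrightarrow> strictly_preperiodic k n (cubic b) 0" for b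
      unfolding strictly_preperiodic_iff[OF n] B_def
      by (auto simp: cpoly_prod poly_prod poly_orbit_poly)
    thus ?thesis
      using ex_monic_rsquarefree[OF orbit_poly_diff_monic[OF n, of k], of B]
      by (simp add: is_preperiodic_poly_def)
  qed
qed (rule is_preperiodic_poly_unique)

lemma preperiodic_poly: "is_preperiodic_poly k n (preperiodic_poly k n)"
  unfolding preperiodic_poly_def by (rule theI'[OF ex1_preperiodic_poly])

end

theory Submission
  imports Defs
begin

text \<open>
  Write \<open>P m\<close> for the polynomial \<open>b \<mapsto> f_b^m(0)\<close>. For \<open>k \<ge> 2\<close> the roots of \<open>R_{k,2}\<close> are roots of
  \<open>Q = 1 + (P k - P (k-1)) (P (k+1) + P k + P (k-1))\<close>, the quotient of
  \<open>P (k+1)^2 + P (k+1) P (k-1) + P (k-1)^2\<close> by \<open>P k^2 + P k P (k-1) + P (k-1)^2\<close>.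
  Modulo 3 the differences of consecutive \<open>P m\<close> are powers of \<open>b\<close>, whence
  \<open>Q \<equiv> (b^2 + 1)^(2 * 3^(k-1))\<close>, while \<open>Q\<close> takes the value 3 at \<open>\<i>\<close> when \<open>k\<close> is even, because
  then 0 has period 2 under \<open>z^3 + \<i>\<close>. So \<open>Q\<close> is irreducible by Eisenstein's argument for the
  prime ideal \<open>(3, b^2 + 1)\<close> of \<open>\<int>[b]\<close>, and hence \<open>R_{k,2} = Q\<close> unless \<open>R_{k,2}\<close> is constant.
\<close>

section \<open>Irreducibility of integer polynomials\<close>

lemma cpoly_numeral [simp]: "cpoly (numeral n) = numeral n"
  by (simp add: numeral_poly map_poly_pCons)

section \<open>Division and invertibility modulo 3\<close>

lemma division_by_unit_lead_coeff:
  fixes f g :: "int poly"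
  assumes "is_unit (lead_coeff g)"
  obtains q r where "f = g * q + r" "r = 0 \<or> degree r < degree g"
proof -
  have g0: "g \<noteq> 0" using assms by auto
  obtain q r where qr: "pseudo_divmod f g = (q, r)" by fastforce
  define l where "l = lead_coeff g ^ (Suc (degree f) - degree g)"
  have "is_unit l" using assms unfolding l_def by (metis dvd_power_same power_one)
  \<comment> \<open>A unit of the integers is its own inverse, so the multiplier of pseudo-division
    can be cancelled.\<close>
  then have l: "l * l = 1" by (auto simp: zdvd1_eq abs_if split: if_splits)
  have eq: "smult l f = g * q + r" "r = 0 \<or> degree r < degree g"
    using pseudo_divmod[OF g0 qr] by (auto simp: l_def)
  have "f = smult l (smult l f)" by (simp add: l)
  also have "\<dots> = g * smult l q + smult l r" by (simp add: eq(1) smult_add_right)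
  finally show ?thesis
    using eq(2) by (intro that[of "smult l q" "smult l r"]) (auto simp: degree_smult_eq)
qed

text \<open>The equation makes \<open>F\<close> a unit modulo 3, and a unit leading coefficient
  survives reduction, so \<open>F\<close> must be constant. Reducing \<open>T\<close> modulo
  \<open>F\<close> turns this into a degree comparison.\<close>

lemma unit_modulo_3_degree_0:
  fixes F W T :: "int poly"
  assumes F: "is_unit (lead_coeff F)" and eq: "F * W + 3 * T = 1"
  shows "degree F = 0"
proof (rule ccontr)
  assume deg: "degree F \<noteq> 0"
  obtain S r where S: "T = F * S + r" "r = 0 \<or> degree r < degree F"
    using division_by_unit_lead_coeff[OF F] by blast
  have F0: "F \<noteq> 0" using F by auto
  have eq': "F * (W + 3 * S) = 1 - 3 * r" using eq S(1) by (simp add: algebra_simps)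
  have "degree (3 * r) \<le> degree r"
    using degree_smult_le[of 3 r] by (simp add: numeral_poly)
  then have lt: "degree (1 - 3 * r) < degree F"
    using S(2) deg by (intro degree_diff_less) auto
  have "W + 3 * S = 0"
  proof (rule ccontr)
    assume nz: "W + 3 * S \<noteq> 0"
    have "degree F \<le> degree (F * (W + 3 * S))"
      using F0 nz by (subst degree_mult_eq) auto
    then show False using lt eq' by simp
  qed
  then have "3 * r = 1" using eq' by simp
  then have "coeff (3 * r) 0 = 1" by simp
  then have "3 * coeff r 0 = 1" by (simp add: numeral_poly)
  then show False by presburger
qed

text \<open>Since -1 is not a square modulo 3, the sum of squares is 1 or 2 modulo 3; the outer
  square makes it 1 in either case.\<close>

lemma not_3_dvd_sum_two_squares:
  fixes c d :: int
  assumes "\<not> (3 dvd c \<and> 3 dvd d)"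
  obtains t where "(c\<^sup>2 + d\<^sup>2)\<^sup>2 = 1 + 3 * t"
proof -
  have "c mod 3 = 0 \<or> c mod 3 = 1 \<or> c mod 3 = 2" "d mod 3 = 0 \<or> d mod 3 = 1 \<or> d mod 3 = 2"
    by presburger+
  then have "((c mod 3)\<^sup>2 + (d mod 3)\<^sup>2)\<^sup>2 mod 3 = 1"
    using assms unfolding dvd_eq_mod_eq_0 by (elim disjE) simp_all
  moreover have "(c\<^sup>2 + d\<^sup>2)\<^sup>2 mod 3 = (((c mod 3)\<^sup>2 + (d mod 3)\<^sup>2)\<^sup>2) mod 3"
  proof -
    have "(c\<^sup>2 + d\<^sup>2) mod 3 = ((c mod 3)\<^sup>2 mod 3 + (d mod 3)\<^sup>2 mod 3) mod 3"
      by (simp only: power_mod mod_add_eq)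
    also have "\<dots> = ((c mod 3)\<^sup>2 + (d mod 3)\<^sup>2) mod 3" by (rule mod_add_eq)
    finally show ?thesis by (metis power_mod)
  qed
  ultimately have "(c\<^sup>2 + d\<^sup>2)\<^sup>2 mod 3 = 1"
    by (simp only:)
  then have "(c\<^sup>2 + d\<^sup>2)\<^sup>2 = 1 + 3 * ((c\<^sup>2 + d\<^sup>2)\<^sup>2 div 3)"
    using mult_div_mod_eq[of 3 "(c\<^sup>2 + d\<^sup>2)\<^sup>2"] by linarith
  then show ?thesis using that by blast
qed

text \<open>A remainder \<open>c x + d\<close> modulo \<open>x\<^sup>2 + 1\<close> that is nonzero modulo 3 has norm \<open>c\<^sup>2 + d\<^sup>2\<close> prime to 3,
  which makes \<open>F\<close> invertible modulo \<open>(3, x\<^sup>2 + 1)\<close>, hence modulo \<open>(3, (x\<^sup>2 + 1)^N)\<close>.\<close>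

lemma factor_in_ideal:
  fixes F E :: "int poly"
  assumes F: "is_unit (lead_coeff F)" "degree F \<noteq> 0"
    and FE: "3 dvd F * E - [:1, 0, 1:] ^ N"
  obtains H K where "F = [:1, 0, 1:] * H + 3 * K"
proof -
  define \<Phi> :: "int poly" where "\<Phi> = [:1, 0, 1:]"
  obtain G where G: "F * E = \<Phi> ^ N + 3 * G"
    using FE by (auto simp: \<Phi>_def algebra_simps elim!: dvdE)
  have "is_unit (lead_coeff \<Phi>)" by (simp add: \<Phi>_def)
  then obtain H r where Hr: "F = \<Phi> * H + r" "r = 0 \<or> degree r < degree \<Phi>"
    using division_by_unit_lead_coeff by blast
  define c d where "c = coeff r 1" and "d = coeff r 0"
  have "degree r \<le> 1" using Hr(2) by (auto simp: \<Phi>_def)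
  then have r: "r = [:d, c:]"
    by (auto simp: c_def d_def poly_eq_iff coeff_pCons coeff_eq_0 split: nat.splits)
  show ?thesis
  proof (cases "3 dvd c \<and> 3 dvd d")
    case True
    then obtain c' d' where "c = 3 * c'" "d = 3 * d'" by (auto elim!: dvdE)
    then have "r = 3 * [:d', c':]" using r by (simp add: numeral_poly)
    then show ?thesis using Hr(1) that unfolding \<Phi>_def by blast
  next
    case False
    then obtain t where t: "(c\<^sup>2 + d\<^sup>2)\<^sup>2 = 1 + 3 * t" using not_3_dvd_sum_two_squares by blast
    define e where "e = c\<^sup>2 + d\<^sup>2"
    \<comment> \<open>Multiplication by the conjugate: modulo \<open>\<Phi>\<close>,
      \<open>r\<close> times \<open>d - c x\<close> is the norm \<open>e\<close>.\<close>
    have norm: "r * [:d, - c:] = [:e:] - \<Phi> * [:c\<^sup>2:]"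
      by (simp add: r e_def \<Phi>_def power2_eq_square)
    have "[:e:] * [:e:] = [:e\<^sup>2:]" by (simp add: power2_eq_square)
    also have "\<dots> = 1 + 3 * [:t:]" using t by (simp add: e_def numeral_poly one_pCons)
    finally have ee: "[:e:] * [:e:] = 1 + 3 * [:t:]" .
    \<comment> \<open>\<open>V\<close> inverts \<open>\<Phi>\<close> modulo \<open>F\<close> and 3:
      substituting \<open>r = F - \<Phi> * H\<close> into \<open>norm\<close> expresses
      \<open>e\<close> through \<open>\<Phi>\<close> and \<open>F\<close>, and the factor
      \<open>e\<close> turns \<open>e\<close> into a square that is 1 modulo 3.\<close>
    define V where "V = [:e:] * ([:c\<^sup>2:] - H * [:d, - c:])"
    have "\<Phi> * V = [:e:] * (\<Phi> * [:c\<^sup>2:] - (F - r) * [:d, - c:])"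
      unfolding V_def using Hr(1) by algebra
    also have "\<dots> = 1 + F * ([:e:] * - [:d, - c:]) + 3 * [:t:]"
      using norm ee by algebra
    finally obtain U where U: "\<Phi> * V = 1 + F * U + 3 * [:t:]" by blast
    have "\<exists>U' T'. (\<Phi> * V) ^ n = 1 + F * U' + 3 * T'" for n
    proof (induction n)
      case 0
      show ?case by (intro exI[of _ 0]) simp
    next
      case (Suc n)
      then obtain U' T' where IH: "(\<Phi> * V) ^ n = 1 + F * U' + 3 * T'" by blast
      have "(\<Phi> * V) ^ Suc n = (1 + F * U + 3 * [:t:]) * (1 + F * U' + 3 * T')"
        unfolding power_Suc IH by (simp only: U)
      also have "\<dots> = 1 + F * (U + U' + F * U * U' + 3 * U * T' + 3 * [:t:] * U')
          + 3 * (T' + [:t:] + 3 * [:t:] * T')" by algebra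
      finally show ?case by blast
    qed
    then obtain U' T' where UT: "(\<Phi> * V) ^ N = 1 + F * U' + 3 * T'" by blast
    \<comment> \<open>\<open>\<Phi> ^ N\<close> is now invertible modulo \<open>F\<close> and 3 but
      also lies in the ideal they generate, so \<open>F\<close> is a unit modulo 3.\<close>
    have "\<Phi> ^ N = F * E - 3 * G" using G by simp
    then have "(F * E - 3 * G) * V ^ N = 1 + F * U' + 3 * T'"
      using UT by (simp only: power_mult_distrib)
    then have "F * (E * V ^ N - U') + 3 * (- G * V ^ N - T') = 1"
      by (simp add: algebra_simps)
    then have "degree F = 0" by (rule unit_modulo_3_degree_0[OF F(1)])
    then show ?thesis using F(2) by contradiction
  qed
qed

section \<open>Irreducibility over the integers\<close>

lemma irreducible_int_polyI:
  fixes Q :: "int poly"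
  assumes Q: "lead_coeff Q = 1" "degree Q \<noteq> 0"
    and fact: "\<And>F G. Q = F * G \<Longrightarrow> is_unit (lead_coeff F) \<Longrightarrow> is_unit (lead_coeff G) \<Longrightarrow>
      degree F \<noteq> 0 \<Longrightarrow> degree G \<noteq> 0 \<Longrightarrow> False"
  shows "irreducible Q"
proof (rule irreducibleI)
  show "Q \<noteq> 0" using Q by auto
  show "\<not> is_unit Q" using Q by (auto simp: is_unit_poly_iff)
next
  fix F G assume FG: "Q = F * G"
  have "lead_coeff F * lead_coeff G = 1" using Q FG by (simp add: lead_coeff_mult)
  then have lc: "is_unit (lead_coeff F)" "is_unit (lead_coeff G)"
    by (metis dvd_triv_left, metis dvd_triv_right)
  then have "degree F = 0 \<or> degree G = 0" using fact[OF FG] by blast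
  then show "is_unit F \<or> is_unit G"
    using lc by (auto elim!: degree_eq_zeroE simp: is_unit_const_poly_iff)
qed

lemma cpoly_at_ii: "\<exists>u v :: int. poly (cpoly p) \<i> = of_int u + of_int v * \<i>"
proof (induction p)
  case (pCons a p)
  then obtain u v :: int where "poly (cpoly p) \<i> = of_int u + of_int v * \<i>" by blast
  then have "poly (cpoly (pCons a p)) \<i> = of_int (a - v) + of_int u * \<i>"
    by (simp add: map_poly_pCons algebra_simps)
  then show ?case by blast
qed (intro exI[of _ 0], simp)

text \<open>Both nonconstant factors lie in the ideal generated by 3 and \<open>x^2 + 1\<close>.
  Evaluation at \<i> kills \<open>x^2 + 1\<close>, so 3 would be 9 times a Gaussian integer.\<close>

lemma eisenstein_at_ii:
  fixes Q :: "int poly"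
  assumes Q: "lead_coeff Q = 1" "degree Q \<noteq> 0"
    and mod3: "3 dvd Q - [:1, 0, 1:] ^ N"
    and Qi: "poly (cpoly Q) \<i> = 3"
  shows "irreducible Q"
proof (rule irreducible_int_polyI[OF Q])
  fix F G assume FG: "Q = F * G" and lc: "is_unit (lead_coeff F)" "is_unit (lead_coeff G)"
    and deg: "degree F \<noteq> 0" "degree G \<noteq> 0"
  obtain H K where F: "F = [:1, 0, 1:] * H + 3 * K"
    using factor_in_ideal[of F G N] lc deg mod3 FG by metis
  obtain H' K' where G: "G = [:1, 0, 1:] * H' + 3 * K'"
    using factor_in_ideal[of G F N] lc deg mod3 FG by (metis mult.commute)
  have \<Phi>: "poly (cpoly [:1, 0, 1:]) \<i> = 0" by (simp add: map_poly_pCons)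
  have "9 * poly (cpoly (K * K')) \<i> = 3"
    using Qi unfolding FG F G cpoly_simps poly_mult poly_add \<Phi> by simp
  moreover obtain u v :: int where "poly (cpoly (K * K')) \<i> = of_int u + of_int v * \<i>"
    using cpoly_at_ii by blast
  ultimately have "9 * real_of_int u = 3" by (auto simp: complex_eq_iff)
  then have "9 * u = 3" by linarith
  then show False by presburger
qed

text \<open>This serves the case \<open>k = 0\<close>, where the value at \<i> is 0 and
  \<open>eisenstein_at_ii\<close> does not apply.\<close>

lemma irreducible_x2_plus_1: "irreducible ([:1, 0, 1:] :: int poly)"
proof (rule irreducible_int_polyI)
  fix F G :: "int poly"
  assume FG: "[:1, 0, 1:] = F * G" and lc: "is_unit (lead_coeff F)"
    and deg: "degree F \<noteq> 0" "degree G \<noteq> 0"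
  have "F \<noteq> 0" "G \<noteq> 0" using deg by auto
  then have "degree F + degree G = 2" using arg_cong[OF FG, of degree] by (simp add: degree_mult_eq)
  then have F1: "degree F = 1" using deg by linarith
  then have F: "F = [:coeff F 0, coeff F 1:]"
    by (auto simp: poly_eq_iff coeff_pCons coeff_eq_0 split: nat.splits)
  have "coeff F 1 * coeff F 1 = 1"
    using lc F1 by (auto simp: zdvd1_eq abs_if split: if_splits)
  \<comment> \<open>The leading coefficient is its own inverse, so the root of the linear factor is
    an integer.\<close>
  then have "poly F (- coeff F 0 * coeff F 1) = 0"
    by (subst F) (simp add: algebra_simps)
  then have "poly [:1, 0, 1:] (- coeff F 0 * coeff F 1) = 0" unfolding FG by simp
  moreover have "poly [:1, 0, 1:] x = 1 + x * x" for x :: int by simp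
  ultimately show False
    by (metis add_nonneg_eq_0_iff zero_le_one zero_le_square zero_neq_one)
qed simp_all

section \<open>Passage to rational coefficients and comparison of roots\<close>

lemma common_denominator:
  fixes A :: "rat poly"
  obtains m :: int and A' :: "int poly"
  where "m \<noteq> 0" "smult (of_int m) A = map_poly of_int A'"
proof -
  have "\<exists>(m :: int) A'. m \<noteq> 0 \<and> smult (of_int m) A = map_poly of_int A'"
  proof (induction A)
    case 0
    show ?case by (intro exI[of _ 1] exI[of _ 0]) simp
  next
    case (pCons a A)
    then obtain m :: int and A' where m: "m \<noteq> 0" "smult (of_int m) A = map_poly of_int A'" by blast
    obtain x y where xy: "a = of_int x / of_int y" "y \<noteq> 0"
      by (metis quotient_of_denom_pos quotient_of_div surj_pair less_irrefl)
    have "smult (of_int (y * m)) (pCons a A) = pCons (of_int (m * x)) (smult (of_int y) (smult (of_int m) A))"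
      using xy by simp
    also have "\<dots> = map_poly of_int (pCons (m * x) (smult y A'))"
      unfolding m(2) by (rule poly_eqI) (simp add: coeff_map_poly coeff_pCons split: nat.splits)
    finally show ?case using m(1) xy(2) by (intro exI[of _ "y * m"] exI) auto
  qed
  then show ?thesis using that by blast
qed

text \<open>A form of Gauss's lemma: after clearing denominators, a nonconstant rational factor
  shares a complex root with the prime element \<open>Q\<close>, hence is divisible by
  \<open>Q\<close> and has full degree.\<close>

lemma irreducible_rat_poly:
  fixes Q :: "int poly"
  assumes irr: "irreducible Q" and deg: "degree Q \<noteq> 0"
  shows "irreducible (map_poly of_int Q :: rat poly)"
proof -
  let ?q = "map_poly of_int Q :: rat poly"
  have cr: "map_poly of_rat (map_poly of_int p :: rat poly) = cpoly p" for p
    by (rule poly_eqI) (simp add: coeff_map_poly)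
  have degq: "degree ?q = degree Q" by (rule degree_map_poly) simp
  have prime: "prime_elem Q" using irr by (rule irreducible_imp_prime_elem)
  have half: "degree Q \<le> degree A" if AB: "?q = A * B" and A: "degree A \<noteq> 0" for A B :: "rat poly"
  proof -
    obtain m :: int and A' where m: "m \<noteq> 0" "smult (of_int m) A = map_poly of_int A'"
      using common_denominator by blast
    have "degree A = degree (smult (of_int m) A)" using m(1) by simp
    also have "\<dots> = degree A'" unfolding m(2) by (rule degree_map_poly) simp
    finally have dA: "degree A = degree A'" .
    have "degree (cpoly A') \<noteq> 0" using A dA by simp
    then obtain b where b: "poly (cpoly A') b = 0"
      using fundamental_theorem_of_algebra constant_degree by metis
    have dvd: "?q * [:of_int m:] = map_poly of_int A' * B"
      unfolding m(2)[symmetric] AB by simp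
    have mp: "map_poly of_rat (p * q) = map_poly of_rat p * (map_poly of_rat q :: complex poly)"
      for p q :: "rat poly"
      by (rule poly_eqI) (simp add: coeff_map_poly coeff_mult of_rat_sum of_rat_mult)
    have "cpoly Q * [:of_int m:] = cpoly A' * map_poly of_rat B"
      using arg_cong[OF dvd, of "map_poly of_rat :: _ \<Rightarrow> complex poly"]
      unfolding mp cr by (simp add: map_poly_pCons)
    then have "poly (cpoly Q * [:of_int m:]) b = 0" using b by simp
    then have "poly (cpoly Q) b = 0" using m(1) by simp
    then have "Q dvd A'" using prime_poly_dvd_of_common_root[OF prime] b by blast
    moreover have "A' \<noteq> 0" using A dA by auto
    ultimately show ?thesis unfolding dA by (intro dvd_imp_degree_le)
  qed
  show ?thesis
  proof (rule irreducibleI)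
    show "?q \<noteq> 0" using degq deg by auto
    then show "\<not> is_unit ?q" using degq deg by (simp add: is_unit_iff_degree)
  next
    fix A B assume AB: "?q = A * B"
    have nz: "A \<noteq> 0" "B \<noteq> 0" using AB degq deg by auto
    then have "degree Q = degree A + degree B" using AB degq by (metis degree_mult_eq)
    then have "degree A = 0 \<or> degree B = 0" using half[OF AB] by linarith
    then show "is_unit A \<or> is_unit B" using nz by (simp add: is_unit_iff_degree)
  qed
qed

text \<open>A common root gives \<open>Q dvd R\<close>; any root of the cofactor would also be a
  root of \<open>Q\<close>, hence a double root of \<open>R\<close>.\<close>

lemma rsquarefree_roots_of_irreducible:
  fixes R Q :: "int poly"
  assumes R: "lead_coeff R = 1" "rsquarefree (cpoly R)" "degree R \<noteq> 0"
    and Q: "lead_coeff Q = 1" "irreducible Q"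
    and roots: "\<And>b. poly (cpoly R) b = 0 \<Longrightarrow> poly (cpoly Q) b = 0"
  shows "R = Q"
proof -
  obtain b where b: "poly (cpoly R) b = 0"
    using R(3) fundamental_theorem_of_algebra constant_degree degree_cpoly by metis
  then have "Q dvd R"
    using prime_poly_dvd_of_common_root roots Q(2) irreducible_imp_prime_elem by blast
  then obtain S where S: "R = Q * S" by blast
  have "degree S = 0"
  proof (rule ccontr)
    assume "degree S \<noteq> 0"
    then obtain c where c: "poly (cpoly S) c = 0"
      using fundamental_theorem_of_algebra constant_degree degree_cpoly by metis
    then have "poly (cpoly R) c = 0" by (simp add: S)
    moreover from this have "poly (cpoly Q) c = 0" by (rule roots)
    then have "poly (pderiv (cpoly R)) c = 0" using c by (simp add: S pderiv_mult)
    ultimately show False using R(2) unfolding rsquarefree_roots by blast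
  qed
  moreover have "lead_coeff S = 1" using R(1) Q(1) by (simp add: S lead_coeff_mult)
  ultimately have "S = 1" by (auto elim!: degree_eq_zeroE)
  then show ?thesis using S by simp
qed

section \<open>The orbit of the critical point\<close>

lemma cube_mod_3:
  fixes u v w :: "int poly"
  assumes "3 dvd u - v - w"
  shows "3 dvd u ^ 3 - v ^ 3 - w ^ 3"
proof -
  obtain g where "u - v - w = 3 * g" using assms by blast
  then have "u = v + w + 3 * g" by (simp add: algebra_simps)
  then have "u ^ 3 - v ^ 3 - w ^ 3 =
      3 * (v * w * (v + w) + 3 * g * (v + w)\<^sup>2 + 9 * g\<^sup>2 * (v + w) + 9 * g ^ 3)"
    by algebra
  then show ?thesis by (simp only: dvd_triv_left)
qed

lemma cube_iterate_mod_3: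
  fixes u v w :: "int poly"
  assumes "3 dvd u - v - w"
  shows "3 dvd u ^ (3 ^ m) - v ^ (3 ^ m) - w ^ (3 ^ m)"
proof (induction m)
  case (Suc m)
  then show ?case using cube_mod_3 by (simp only: power_Suc2 power_mult)
qed (use assms in simp)

text \<open>The added \<open>b\<close> cancels in differences, so modulo 3 each consecutive
  difference is the cube of the previous one, starting from \<open>b\<close>.\<close>

lemma orbit_poly_diff_mod_3:
  "3 dvd orbit_poly (Suc m) - orbit_poly m - [:0, 1:] ^ (3 ^ m)"
proof (induction m)
  case (Suc m)
  then have "3 dvd orbit_poly (Suc m) ^ 3 - orbit_poly m ^ 3 - ([:0, 1:] ^ (3 ^ m)) ^ 3"
    by (rule cube_mod_3)
  moreover have "([:0, 1:] ^ (3 ^ m)) ^ 3 = ([:0, 1:] :: int poly) ^ (3 ^ Suc m)"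
    by (simp only: power_Suc2 power_mult)
  ultimately show ?case
    by (metis add_diff_cancel_right orbit_poly.simps(2))
qed simp

text \<open>The polynomial \<open>Q\<close> for preperiod \<open>k = m + 1\<close>.\<close>

definition mis_poly :: "nat \<Rightarrow> int poly" where
  "mis_poly m = 1 + (orbit_poly (Suc m) - orbit_poly m) *
    (orbit_poly (Suc (Suc m)) + orbit_poly (Suc m) + orbit_poly m)"

lemma mis_poly_mod_3: "3 dvd mis_poly m - [:1, 0, 1:] ^ (2 * 3 ^ m)"
proof -
  define W :: "int poly" where "W = [:0, 1:] ^ (3 ^ m)"
  let ?X = "orbit_poly (Suc (Suc m))" and ?Y = "orbit_poly m" and ?Z = "orbit_poly (Suc m)"
  obtain g where g: "?Z - ?Y - W = 3 * g"
    using orbit_poly_diff_mod_3[of m] by (auto simp: W_def)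
  have "[:0, 1:] ^ (3 ^ Suc m) = W ^ 3"
    by (simp only: W_def power_Suc2 power_mult)
  then obtain h where h: "?X - ?Z - W ^ 3 = 3 * h"
    using orbit_poly_diff_mod_3[of "Suc m"] by (metis dvdE)
  have "3 dvd ([:1, 0, 1:] :: int poly) - 1 - [:0, 1:]\<^sup>2"
    by (simp add: power2_eq_square one_pCons)
  then have "3 dvd ([:1, 0, 1:] :: int poly) ^ (3 ^ m) - 1 ^ (3 ^ m) - ([:0, 1:]\<^sup>2) ^ (3 ^ m)"
    by (rule cube_iterate_mod_3)
  moreover have "([:0, 1:]\<^sup>2) ^ (3 ^ m) = W\<^sup>2"
    unfolding W_def by (metis mult.commute power_mult)
  ultimately obtain s where s: "[:1, 0, 1:] ^ (3 ^ m) - 1 - W\<^sup>2 = 3 * s" by (auto elim!: dvdE)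
  define T where "T = ([:1, 0, 1:] :: int poly) ^ (3 ^ m)"
  have T: "T = 1 + W\<^sup>2 + 3 * s" using s by (simp add: T_def algebra_simps)
  \<comment> \<open>The sum is \<open>(X - Z) + 2 (Z - Y) + 3 Y\<close>. Modulo 3 this gives
    \<open>1 + W (W^3 + 2 W) = (1 + W^2)^2\<close>.\<close>
  have "?Z - ?Y = W + 3 * g" "?X + ?Z + ?Y = W ^ 3 + 2 * W + 3 * (h + 2 * g + ?Y)"
    using g h by algebra+
  then have "mis_poly m - T\<^sup>2 = 3 * (g * (W ^ 3 + 2 * W + 3 * (h + 2 * g + ?Y)) +
      W * (h + 2 * g + ?Y) - 2 * s * (1 + W\<^sup>2) - 3 * s\<^sup>2)"
    unfolding mis_poly_def T by algebra
  moreover have "[:1, 0, 1:] ^ (2 * 3 ^ m) = T\<^sup>2"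
    unfolding T_def by (metis mult.commute power_mult)
  ultimately show ?thesis by (simp only: dvd_triv_left)
qed

lemma mis_poly_monic:
  assumes "m > 0"
  shows "lead_coeff (mis_poly m) = 1" "degree (mis_poly m) \<noteq> 0"
proof -
  let ?X = "orbit_poly (Suc (Suc m))" and ?Y = "orbit_poly m" and ?Z = "orbit_poly (Suc m)"
  obtain j where j: "m = Suc j" using assms by (cases m) auto
  have dX: "degree ?X = 3 ^ Suc m" "lead_coeff ?X = 1"
    and dZ: "degree ?Z = 3 ^ m" and dY: "degree ?Y = 3 ^ j"
    using orbit_poly_degree_monic[of "Suc m"] orbit_poly_degree_monic[of m]
      orbit_poly_degree_monic[of j] j by auto
  have lt: "degree (?Z + ?Y) < degree ?X"
    unfolding dX by (intro degree_add_less) (simp_all only: dZ dY, simp_all add: j)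
  have sum: "?X + ?Z + ?Y = ?X + (?Z + ?Y)" by simp
  have S: "lead_coeff (?X + ?Z + ?Y) = 1" "degree (?X + ?Z + ?Y) = 3 ^ Suc m"
    unfolding sum using degree_add_eq_left[OF lt] lead_coeff_add_le[OF lt] dX
    by (simp_all add: add.commute del: orbit_poly.simps)
  have D: "lead_coeff (?Z - ?Y) = 1" using orbit_poly_diff_monic[of 1 m] by simp
  let ?M = "(?Z - ?Y) * (?X + ?Z + ?Y)"
  have M: "lead_coeff ?M = 1" using D S(1) by (simp only: lead_coeff_mult mult_1)
  have "degree ?M = degree (?Z - ?Y) + degree (?X + ?Z + ?Y)"
  proof (rule degree_mult_eq)
    show "?Z - ?Y \<noteq> 0" using D by (metis leading_coeff_0_iff zero_neq_one)
    show "?X + ?Z + ?Y \<noteq> 0" using S(1) by (metis leading_coeff_0_iff zero_neq_one)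
  qed
  then have dM: "degree (1 :: int poly) < degree ?M" using S(2) by simp
  have "degree (mis_poly m) = degree ?M"
    unfolding mis_poly_def by (rule degree_add_eq_right[OF dM])
  then show "degree (mis_poly m) \<noteq> 0" using dM by simp
  show "lead_coeff (mis_poly m) = 1"
    unfolding mis_poly_def lead_coeff_add_le[OF dM] M ..
qed

lemma orbit_poly_at_ii: "poly (cpoly (orbit_poly m)) \<i> = (if even m then 0 else \<i>)"
  by (induction m) (auto simp: map_poly_pCons power3_eq_cube)

text \<open>For odd \<open>m\<close> the three consecutive orbit values are \<i>, 0, \<i>, so the
  value is \<open>1 + (-\<i>) (2 \<i>)\<close>.\<close>

lemma mis_poly_at_ii:
  assumes "odd m"
  shows "poly (cpoly (mis_poly m)) \<i> = 3"
  using assms by (simp add: mis_poly_def orbit_poly_at_ii complex_eq_iff del: orbit_poly.simps)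

lemma irreducible_mis_poly: "odd m \<Longrightarrow> irreducible (mis_poly m)"
  using eisenstein_at_ii[OF mis_poly_monic mis_poly_mod_3 mis_poly_at_ii] by (simp add: odd_pos)

lemma mis_poly_root:
  assumes "strictly_preperiodic (Suc m) 2 (cubic b) 0"
  shows "poly (cpoly (mis_poly m)) b = 0"
proof -
  define y where "y = (cubic b ^^ m) 0"
  define z where "z = cubic b y"
  define x where "x = cubic b z"
  have o: "poly (cpoly (orbit_poly m)) b = y" "poly (cpoly (orbit_poly (Suc m))) b = z"
    "poly (cpoly (orbit_poly (Suc (Suc m)))) b = x"
    unfolding poly_orbit_poly x_def z_def y_def by simp_all
  have "\<forall>i\<in>{0<..<2}. (cubic b ^^ (Suc m + i)) 0 \<noteq> (cubic b ^^ Suc m) 0"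
    "\<forall>l<Suc m. (cubic b ^^ (l + 2)) 0 \<noteq> (cubic b ^^ l) 0" "(cubic b ^^ (Suc m + 2)) 0 = (cubic b ^^ Suc m) 0"
    using assms unfolding strictly_preperiodic_iff[OF zero_less_numeral] by blast+
  \<comment> \<open>The instance 1 excludes a fixed point and the instance \<open>m\<close> excludes
    a shorter preperiod.\<close>
  from bspec[OF this(1), of 1] spec[OF this(2), of m] this(3)
  have "cubic b x = z" "x \<noteq> y" "x \<noteq> z"
    by (simp_all add: x_def z_def y_def)
  then have eqs: "x ^ 3 = y ^ 3" "x - y \<noteq> 0" "x - z \<noteq> 0" "x - z = z ^ 3 - y ^ 3"
    by (auto simp: x_def z_def cubic_def)
  \<comment> \<open>Once the middle factor is recognised as \<open>x - z\<close>, both cofactors of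
    the desired expression are nonzero, while the right side vanishes because \<open>x\<close> and
    \<open>y\<close> have equal cubes.\<close>
  have "(x - y) * ((z - y) * (z\<^sup>2 + z * y + y\<^sup>2)) * (1 + (z - y) * (x + z + y)) =
      (x ^ 3 - y ^ 3) * (z - y)"
    using eqs(4) by algebra
  also have "(z - y) * (z\<^sup>2 + z * y + y\<^sup>2) = x - z" using eqs(4) by algebra
  finally have "1 + (z - y) * (x + z + y) = 0" using eqs by simp
  then show ?thesis by (simp add: mis_poly_def o map_poly_pCons del: orbit_poly.simps)
qed

theorem theorem1p5:
  fixes k :: nat
  assumes "even k"
  shows "degree (preperiodic_poly k 2) = 0 \<or>
    irreducible (map_poly of_int (preperiodic_poly k 2) :: rat poly)"
proof (cases "degree (preperiodic_poly k 2) = 0")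
  case deg: False
  let ?R = "preperiodic_poly k 2"
  have R: "lead_coeff ?R = 1" "rsquarefree (cpoly ?R)"
    "\<And>b. poly (cpoly ?R) b = 0 \<longleftrightarrow> strictly_preperiodic k 2 (cubic b) 0"
    using preperiodic_poly[of k 2] by (auto simp: is_preperiodic_poly_def)
  obtain Q where Q: "lead_coeff Q = 1" "irreducible Q"
    "\<And>b. strictly_preperiodic k 2 (cubic b) 0 \<Longrightarrow> poly (cpoly Q) b = 0"
  proof (cases k)
    case 0
    have "poly (cpoly [:1, 0, 1:]) b = 0" if "strictly_preperiodic k 2 (cubic b) 0" for b
    proof -
      \<comment> \<open>The orbit of 0 starts 0, \<open>b\<close>, \<open>b^3 + b\<close>; period
        exactly 2 excludes \<open>b = 0\<close>.\<close>
      have "(b ^ 3 + b = 0) \<and> b \<noteq> 0"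
        using that unfolding 0 strictly_preperiodic_iff[OF zero_less_numeral]
        by (auto simp: numeral_2_eq_2 cubic_def dest: bspec[of _ _ 1])
      then have "b * (b * b + 1) = 0" "b \<noteq> 0" by (auto simp: algebra_simps power3_eq_cube)
      then have "b * b + 1 = 0" by simp
      then show ?thesis by (simp add: map_poly_pCons add.commute)
    qed
    then show ?thesis using that[OF _ irreducible_x2_plus_1] by simp
  next
    case (Suc m)
    then have "odd m" using assms by simp
    then show ?thesis
      using that[OF mis_poly_monic(1) irreducible_mis_poly mis_poly_root] Suc by (simp add: odd_pos)
  qed
  \<comment> \<open>Only one inclusion of roots is known so far; irreducibility of \<open>Q\<close>
    and nonconstancy of \<open>?R\<close> force equality.\<close>
  have "?R = Q"
    using rsquarefree_roots_of_irreducible[OF R(1,2) deg Q(1,2)] R(3) Q(3) by blast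
  then show ?thesis using irreducible_rat_poly Q(2) deg by metis
qed simp

end
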